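(* Let $S$ be a semiring and $M$ a totally ordered monoid. Then the following statements are equivalent: (1) For all $f$ and $g$ in $S[M]$, $\deg(f+g) = \max \{\deg(f),\deg(g)\}$. (2) The semiring $S$ is zerosumfree. (3) The semiring $S[M]$ is zerosumfree.
   Context: A semiring is a set $S$ with operations $+,\cdot$ such that $(S,+,0)$ and $(S,\cdot,1)$ are commutative monoids with $1\neq 0$, multiplication distributes over addition, and $s\cdot 0=0$ for all $s$. $S$ is zerosumfree if $a+b=0$ implies $a=b=0$ for all $a,b\in S$. A (commutative, additive) monoid $M$ is totally ordered if it carries a total order $<$ such that $a<b$ implies $a+c<b+c$ for all $a,b,c\in M$. $S[M]$ is the monoid semiring, whose elements are finite formal sums $\sum_i s_iX^{m_i}$ with $s_i\in S$, $m_i\in M$, and $X^mX^{m'}=X^{m+m'}$. The degree takes values in $M\cup\{-\infty\}$, where $-\infty<m$ for all $m\in M$: $\deg(0)=-\infty$, and if $f=\sum_{i=1}^n a_iX^{m_i}$ with all $a_i\ne0$ and $m_1<\dots<m_n$ ($n\ge1$), then $\deg(f)=m_n$. *)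

theory Defs
  imports "HOL-Library.Poly_Mapping" "HOL-Library.Option_ord"
begin

text \<open>
  Semirings are types of class \<^class>\<open>comm_semiring_1\<close>, and \<open>S[M]\<close> is the type \<open>'m \<Rightarrow>\<^sub>0 's\<close> of
  finitely supported functions with convolution product.

  The library's \<^class>\<open>linordered_cancel_ab_semigroup_add\<close> is deliberately not used: it presupposes
  a subtraction operation satisfying further axioms, which a totally ordered monoid need not have.
\<close>

class totally_ordered_monoid = comm_monoid_add + linorder +
  assumes add_less_add: "a < b \<Longrightarrow> a + c < b + c"

definition zerosumfree :: "'a::comm_semiring_1 itself \<Rightarrow> bool" where
  "zerosumfree _ \<longleftrightarrow> (\<forall>a b :: 'a. a + b = 0 \<longrightarrow> a = 0 \<and> b = 0)"

text \<open>
  \<open>M \<union> {-\<infinity>}\<close> is \<open>'m option\<close>, with \<^const>\<open>None\<close> as \<open>-\<infinity>\<close>; in the order on options used here,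
  \<^const>\<open>None\<close> lies strictly below every \<open>Some m\<close>.
\<close>

definition deg :: "('m::totally_ordered_monoid \<Rightarrow>\<^sub>0 's::comm_semiring_1) \<Rightarrow> 'm option" where
  "deg f = (if f = 0 then None else Some (Max (Poly_Mapping.keys f)))"

end

theory Submission
  imports Defs
begin

text \<open>
  Over a zerosumfree semiring nothing cancels in a sum, so the support of \<open>f + g\<close> is the union of
  the supports and its largest exponent is the maximum of the two degrees. Conversely, if degrees
  combine by the maximum, then \<open>f + g = 0\<close> bounds both degrees by \<open>-\<infinity>\<close>, so \<open>S[M]\<close> is zerosumfree;
  and \<open>S\<close> inherits this property as the semiring of constants of \<open>S[M]\<close>.
\<close>

lemma zerosumfree_add_eq_0_iff:
  fixes a b :: "'a::comm_semiring_1"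
  assumes "zerosumfree TYPE('a)"
  shows "a + b = 0 \<longleftrightarrow> a = 0 \<and> b = 0"
  using assms unfolding zerosumfree_def by (metis add_0)

lemma zerosumfree_if_inj_additive:
  fixes h :: "'a::comm_semiring_1 \<Rightarrow> 'b::comm_semiring_1"
  assumes "inj h" and h_0: "h 0 = 0" and h_add: "\<And>a b. h (a + b) = h a + h b"
    and zerosumfree: "zerosumfree TYPE('b)"
  shows "zerosumfree TYPE('a)"
  unfolding zerosumfree_def
proof (intro allI impI)
  fix a b :: 'a
  assume "a + b = 0"
  then have "h a + h b = 0"
    by (simp flip: h_add add: h_0)
  then have "h a = h 0 \<and> h b = h 0"
    by (simp add: zerosumfree_add_eq_0_iff[OF zerosumfree] h_0)
  then show "a = 0 \<and> b = 0"
    using \<open>inj h\<close> by (simp add: inj_eq)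
qed

lemma zerosumfree_if_poly_mapping:
  assumes "zerosumfree TYPE('m::comm_monoid_add \<Rightarrow>\<^sub>0 's::comm_semiring_1)"
  shows "zerosumfree TYPE('s)"
proof (rule zerosumfree_if_inj_additive)
  show "inj (Poly_Mapping.single (0::'m) :: 's \<Rightarrow> _)"
    by (rule inj_single)
qed (use assms in \<open>simp_all add: single_add\<close>)

lemma keys_add_zerosumfree:
  fixes f g :: "'m \<Rightarrow>\<^sub>0 's::comm_semiring_1"
  assumes "zerosumfree TYPE('s)"
  shows "Poly_Mapping.keys (f + g) = Poly_Mapping.keys f \<union> Poly_Mapping.keys g"
  using assms by (auto simp: in_keys_iff lookup_add zerosumfree_add_eq_0_iff)

lemma deg_le_None_iff: "deg f \<le> None \<longleftrightarrow> f = 0"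
  by (simp add: deg_def)

lemma deg_eq_Max: "deg f = Max (insert None (Some ` Poly_Mapping.keys f))"
proof (cases "f = 0")
  case False
  then have "Some (Max (Poly_Mapping.keys f)) = Max (Some ` Poly_Mapping.keys f)"
    by (intro mono_Max_commute) (auto simp: mono_def)
  with False show ?thesis
    by (simp add: deg_def max_def)
qed (simp add: deg_def)

lemma deg_add_zerosumfree:
  fixes f g :: "'m::totally_ordered_monoid \<Rightarrow>\<^sub>0 's::comm_semiring_1"
  assumes "zerosumfree TYPE('s)"
  shows "deg (f + g) = max (deg f) (deg g)"
proof -
  have "deg (f + g) = Max (insert None (Some ` Poly_Mapping.keys f) \<union>
      insert None (Some ` Poly_Mapping.keys g))"
    using assms by (simp add: deg_eq_Max keys_add_zerosumfree image_Un)
  also have "\<dots> = max (deg f) (deg g)"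
    unfolding deg_eq_Max by (rule Max_Un) auto
  finally show ?thesis .
qed

lemma zerosumfree_poly_mapping_if_deg_add:
  assumes deg_add: "\<And>f g :: 'm::totally_ordered_monoid \<Rightarrow>\<^sub>0 's::comm_semiring_1.
    deg (f + g) = max (deg f) (deg g)"
  shows "zerosumfree TYPE('m \<Rightarrow>\<^sub>0 's)"
  unfolding zerosumfree_def
proof (intro allI impI)
  fix f g :: "'m \<Rightarrow>\<^sub>0 's"
  assume "f + g = 0"
  then have "deg (f + g) \<le> None"
    by (simp only: deg_le_None_iff)
  then have "deg f \<le> None \<and> deg g \<le> None"
    by (simp only: deg_add max.bounded_iff)
  then show "f = 0 \<and> g = 0"
    by (simp only: deg_le_None_iff)
qed

theorem theorem5p15:
  shows "((\<forall>f g :: 'm::totally_ordered_monoid \<Rightarrow>\<^sub>0 's::comm_semiring_1.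
             deg (f + g) = max (deg f) (deg g))
           \<longleftrightarrow> zerosumfree TYPE('s))
       \<and> (zerosumfree TYPE('s) \<longleftrightarrow> zerosumfree TYPE('m \<Rightarrow>\<^sub>0 's))"
    (is "(?deg_add \<longleftrightarrow> ?S_zerosumfree) \<and> (_ \<longleftrightarrow> ?SM_zerosumfree)")
proof -
  have "?S_zerosumfree \<Longrightarrow> ?deg_add"
    by (simp add: deg_add_zerosumfree)
  moreover have "?deg_add \<Longrightarrow> ?SM_zerosumfree"
    by (simp add: zerosumfree_poly_mapping_if_deg_add)
  moreover have "?SM_zerosumfree \<Longrightarrow> ?S_zerosumfree"
    by (rule zerosumfree_if_poly_mapping)
  ultimately show ?thesis
    by blast
qed

end
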